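(* Let $a:\mathbb{R}\to\mathbb{R}_+$ be differentiable and strictly convex, and consider the scalar conservation law with random initial data $$\partial_t u+\partial_x\big(a(u)\big)=0,\qquad u(0,x;\omega)=u_{(0,x)}(\omega).$$ Assume that there is $T\le\infty$ such that, for $\mu$-almost every $\omega\in\Omega$: (i) $u_{(0,x)}(\omega)>0$; and (ii) a unique strong solution of the initial value problem exists for times $t\in[0,T]$ (no shock forms up to time $T$). Let $F(t,x,U)=\phi_{t,x}((-\infty,U])$ be the cumulative distribution function of the pointwise statistics $\phi_{t,x}=u(t,x;\cdot)_\sharp\mu$. Then for all such $t$, $$\begin{cases}\partial_t F(t,x,U)+a'(U)\,\partial_x F(t,x,U)=0,\\ F(0,x,U)=F_{(0,x)}(U),\end{cases}$$ where $F_{(0,x)}$ is the cumulative distribution function of $\phi_{0,x}$. Equivalently, $F(t,x,U)=F(0,x-a'(U)t,U)$.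
   Context: $\Omega\subseteq\mathbb{R}^d$ is equipped with a Borel probability measure $\mu$. For every $x\in\mathbb{R}$ the initial datum $u_{(0,x)}:\Omega\to\mathbb{R}$ is measurable. For fixed $(t,x)$, the pointwise statistics $\phi_{t,x}$ is the pushforward probability measure on $\mathbb{R}$ given by $\phi_{t,x}(A)=\mu(\{\omega\in\Omega:u(t,x;\omega)\in A\})$ for all Borel $A\subseteq\mathbb{R}$. It is assumed throughout that up to time $T$ no shocks have formed, i.e. the solution is given by the method of characteristics: $u$ is constant along the straight lines $x=x_0+a'(u_{(0,x_0)}(\omega))\,t$, and these lines do not cross. *)

theory Defs
  imports "HOL-Probability.Probability"
begin

definition strictly_convex :: "(real \<Rightarrow> real) \<Rightarrow> bool" where
  "strictly_convex a \<longleftrightarrow>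
     (\<forall>x y s. x \<noteq> y \<longrightarrow> 0 < s \<longrightarrow> s < 1 \<longrightarrow>
        a ((1 - s) * x + s * y) < (1 - s) * a x + s * a y)"

(* The time interval [0,T], which is [0,\<infinity>) for T = \<infinity>. *)
definition times_upto :: "ereal \<Rightarrow> real set" where
  "times_upto T = {t. 0 \<le> t \<and> ereal t \<le> T}"

(* Strong (classical) solution in the usual sense for conservation laws: locally Lipschitz in the
   open strip, continuous up to the boundary, and satisfying the equation pointwise almost
   everywhere.  C1 solutions are included.  Values u t x with t outside [0,T] are irrelevant. *)
definition strong_solution ::
    "(real \<Rightarrow> real) \<Rightarrow> ereal \<Rightarrow> (real \<Rightarrow> real) \<Rightarrow> (real \<Rightarrow> real \<Rightarrow> real) \<Rightarrow> bool" where
  "strong_solution a T v u \<longleftrightarrow>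
     continuous_on (times_upto T \<times> UNIV) (\<lambda>(t, x). u t x) \<and>
     (\<forall>K. compact K \<and> K \<subseteq> {t. 0 < t \<and> ereal t < T} \<times> UNIV \<longrightarrow>
        (\<exists>L. L-lipschitz_on K (\<lambda>(t, x). u t x))) \<and>
     (AE (t, x) in lborel. 0 < t \<and> ereal t < T \<longrightarrow>
        (\<exists>ut ax. ((\<lambda>s. u s x) has_real_derivative ut) (at t) \<and>
                 ((\<lambda>y. a (u t y)) has_real_derivative ax) (at x) \<and>
                 ut + ax = 0)) \<and>
     (\<forall>x. u 0 x = v x)"

definition unique_strong_solution ::
    "(real \<Rightarrow> real) \<Rightarrow> ereal \<Rightarrow> (real \<Rightarrow> real) \<Rightarrow> (real \<Rightarrow> real \<Rightarrow> real) \<Rightarrow> bool" where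
  "unique_strong_solution a T v u \<longleftrightarrow>
     strong_solution a T v u \<and>
     (\<forall>w. strong_solution a T v w \<longrightarrow> (\<forall>t\<in>times_upto T. \<forall>x. w t x = u t x))"

(* u is constant along the characteristic lines x = x0 + a'(v x0) t, and lines with different
   foot points x0 do not meet at any time in [0,T]. *)
definition no_shock ::
    "(real \<Rightarrow> real) \<Rightarrow> ereal \<Rightarrow> (real \<Rightarrow> real) \<Rightarrow> (real \<Rightarrow> real \<Rightarrow> real) \<Rightarrow> bool" where
  "no_shock a T v u \<longleftrightarrow>
     (\<forall>t\<in>times_upto T. \<forall>x0. u t (x0 + deriv a (v x0) * t) = v x0) \<and>
     (\<forall>t\<in>times_upto T. inj (\<lambda>x0. x0 + deriv a (v x0) * t))"

(* The solution is prescribed only for almost every outcome, so u(t,x) is in general measurable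
   only for the completion of the underlying measure.  For measurable X this is just
   distr M borel X, see the next lemma. *)
definition pointwise_statistics :: "'w measure \<Rightarrow> ('w \<Rightarrow> real) \<Rightarrow> real measure" where
  "pointwise_statistics M X = distr (completion M) borel X"

lemma pointwise_statistics_measurable:
  "X \<in> borel_measurable M \<Longrightarrow> pointwise_statistics M X = distr M borel X"
  by (simp add: pointwise_statistics_def distr_completion)

definition statistics_cdf ::
    "'w measure \<Rightarrow> (real \<Rightarrow> real \<Rightarrow> 'w \<Rightarrow> real) \<Rightarrow> real \<Rightarrow> real \<Rightarrow> real \<Rightarrow> real" where
  "statistics_cdf M u t x U = cdf (pointwise_statistics M (u t x)) U"

(* \<psi> is a C1 function with partial derivatives \<psi>t, \<psi>x and compact support in
   (-\<infinity>,T) x R; its restriction to t \<ge> 0 need not vanish at t = 0. *)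
definition test_function ::
    "ereal \<Rightarrow> (real \<times> real \<Rightarrow> real) \<Rightarrow> (real \<times> real \<Rightarrow> real) \<Rightarrow> (real \<times> real \<Rightarrow> real) \<Rightarrow> bool" where
  "test_function T \<psi> \<psi>t \<psi>x \<longleftrightarrow>
     (\<forall>p. (\<psi> has_derivative (\<lambda>h. \<psi>t p * fst h + \<psi>x p * snd h)) (at p)) \<and>
     continuous_on UNIV \<psi>t \<and> continuous_on UNIV \<psi>x \<and>
     compact (closure {p. \<psi> p \<noteq> 0}) \<and>
     closure {p. \<psi> p \<noteq> 0} \<subseteq> {p. ereal (fst p) < T}"

(* Weak form of  G_t + c G_x = 0 on (0,T) x R,  G(0,.) = g.  Integrability is required explicitly,
   since the Bochner integral of a non-integrable function is 0 by convention. *)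
definition weak_transport_solution ::
    "ereal \<Rightarrow> real \<Rightarrow> (real \<Rightarrow> real \<Rightarrow> real) \<Rightarrow> (real \<Rightarrow> real) \<Rightarrow> bool" where
  "weak_transport_solution T c G g \<longleftrightarrow>
     (\<forall>\<psi> \<psi>t \<psi>x. test_function T \<psi> \<psi>t \<psi>x \<longrightarrow>
        set_integrable lborel (times_upto T \<times> UNIV)
          (\<lambda>(t, x). G t x * (\<psi>t (t, x) + c * \<psi>x (t, x))) \<and>
        integrable lborel (\<lambda>x. g x * \<psi> (0, x)) \<and>
        (LINT p:times_upto T \<times> UNIV|lborel.
            G (fst p) (snd p) * (\<psi>t p + c * \<psi>x p))
          + (LINT x|lborel. g x * \<psi> (0, x)) = 0)"

(* The same equation pointwise: at every point where G(t,.) has a derivative, the time derivative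
   exists as well (one-sided at the end points of [0,T]) and the equation holds. *)
definition pointwise_transport_solution ::
    "ereal \<Rightarrow> real \<Rightarrow> (real \<Rightarrow> real \<Rightarrow> real) \<Rightarrow> bool" where
  "pointwise_transport_solution T c G \<longleftrightarrow>
     (\<forall>t\<in>times_upto T. \<forall>x. (\<lambda>y. G t y) differentiable (at x) \<longrightarrow>
        (\<exists>Gt Gx. ((\<lambda>s. G s x) has_real_derivative Gt) (at t within times_upto T) \<and>
                 ((\<lambda>y. G t y) has_real_derivative Gx) (at x) \<and>
                 Gt + c * Gx = 0))"

end

theory Submission
  imports Defs
begin

text \<open>For almost every outcome the foot-point map \<open>X x0 = x0 + a'(u0 x0) t\<close> is an increasing bijection of the
  line.  Comparing the characteristic through \<open>(t, x)\<close> with the straight line of slope \<open>a'(U)\<close> through the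
  same point, monotonicity of \<open>a'\<close> and of \<open>X\<close> gives \<open>u(t,x) \<le> U \<longleftrightarrow> u0(x - a'(U) t) \<le> U\<close>; taking
  probabilities yields \<open>F(t,x,U) = F(0,x - a'(U) t,U)\<close>.  The weak form of the transport equation
  then follows by the shear \<open>x = y + a'(U) t\<close>, Fubini and the fundamental theorem of calculus along
  the lines of slope \<open>a'(U)\<close>.\<close>

section \<open>The derivative of a convex function\<close>

lemma strictly_convex_imp_convex_on:
  assumes "strictly_convex a"
  shows "convex_on UNIV a"
proof (rule convex_onI)
  fix s x y :: real
  assume "0 < s" "s < 1"
  then show "a ((1 - s) *\<^sub>R x + s *\<^sub>R y) \<le> (1 - s) * a x + s * a y"
    using assms unfolding strictly_convex_def
    by (cases "x = y") (simp add: algebra_simps, simp add: less_imp_le)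
qed auto

context
  fixes a :: "real \<Rightarrow> real"
  assumes conv: "convex_on UNIV a"
    and diff: "\<And>v. a differentiable (at v)"
begin

lemma convex_above_tangent: "deriv a x * (y - x) \<le> a y - a x"
  using convex_on_imp_above_tangent[of UNIV a x y "deriv a x"] conv diff[of x]
  by (simp add: DERIV_deriv_iff_real_differentiable)

lemma convex_mono_deriv: "mono (deriv a)"
proof (rule monoI)
  fix x y :: real
  assume "x \<le> y"
  show "deriv a x \<le> deriv a y"
  proof (cases "x = y")
    case False
    then have "0 < y - x" using \<open>x \<le> y\<close> by simp
    have "deriv a x * (y - x) \<le> deriv a y * (y - x)"
      using convex_above_tangent[of x y] convex_above_tangent[of y x] by (simp add: algebra_simps)
    then show ?thesis using \<open>0 < y - x\<close> by simp
  qed simp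
qed

text \<open>By the tangent inequality a difference quotient with fixed step \<open>h\<close> bounds
  \<open>deriv a y\<close> from below if \<open>h < 0\<close> and from above if
  \<open>h > 0\<close>. These quotients are continuous in \<open>y\<close> and tend to
  \<open>deriv a v\<close> at \<open>v\<close> as \<open>h\<close> tends to 0, so both one-sided
  bounds persist near \<open>v\<close>.\<close>

lemma convex_continuous_on_deriv: "continuous_on UNIV (deriv a)"
proof (rule continuous_at_imp_continuous_on, rule ballI)
  fix v :: real
  have D: "(\<lambda>h. (a (v + h) - a v) / h) \<midarrow>0\<rightarrow> deriv a v"
    using diff[of v] by (simp add: DERIV_deriv_iff_real_differentiable[symmetric] DERIV_def)
  have "continuous_on UNIV a"
    using diff by (auto intro!: continuous_at_imp_continuous_on differentiable_imp_continuous_within)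
  then have quot: "isCont (\<lambda>y. (a (y + h) - a y) / h) v" if "h \<noteq> 0" for h
    using that by (auto intro!: continuous_intros simp: continuous_on_eq_continuous_at
        intro: isCont_o2[of _ "\<lambda>y. y + h" a])
  show "isCont (deriv a) v"
    unfolding isCont_def
  proof (rule order_tendstoI)
    fix l assume l: "l < deriv a v"
    have "\<forall>\<^sub>F h in at_left 0. l < (a (v + h) - a v) / h \<and> h < 0"
      using order_tendstoD(1)[OF tendsto_within_subset[OF D subset_UNIV, of "{..<0}"] l]
      by (auto simp: eventually_conj_iff eventually_at_filter)
    then obtain h where h: "l < (a (v + h) - a v) / h" "h < 0"
      using eventually_happens'[OF trivial_limit_at_left_real] by blast
    have "\<forall>\<^sub>F y in at v. l < (a (y + h) - a y) / h"
      using quot[of h] h unfolding isCont_def by (intro order_tendstoD(1)) auto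
    then show "\<forall>\<^sub>F y in at v. l < deriv a y"
    proof eventually_elim
      case (elim y)
      then show ?case
        using convex_above_tangent[of y "y + h"] h(2)
        by (intro less_le_trans[OF elim]) (simp add: neg_divide_le_eq)
    qed
  next
    fix l assume l: "deriv a v < l"
    have "\<forall>\<^sub>F h in at_right 0. (a (v + h) - a v) / h < l \<and> 0 < h"
      using order_tendstoD(2)[OF tendsto_within_subset[OF D subset_UNIV, of "{0<..}"] l]
      by (auto simp: eventually_conj_iff eventually_at_filter)
    then obtain h where h: "(a (v + h) - a v) / h < l" "0 < h"
      using eventually_happens'[OF trivial_limit_at_right_real] by blast
    have "\<forall>\<^sub>F y in at v. (a (y + h) - a y) / h < l"
      using quot[of h] h unfolding isCont_def by (intro order_tendstoD(2)) auto
    then show "\<forall>\<^sub>F y in at v. deriv a y < l"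
    proof eventually_elim
      case (elim y)
      then show ?case
        using convex_above_tangent[of y "y + h"] h(2)
        by (intro le_less_trans[OF _ elim]) (simp add: pos_le_divide_eq)
    qed
  qed
qed

end

section \<open>Characteristics and sublevel sets\<close>

lemma non_crossing_imp_strict_mono:
  fixes b v :: "real \<Rightarrow> real"
  assumes "0 \<le> t" and inj: "\<And>s. 0 \<le> s \<Longrightarrow> s \<le> t \<Longrightarrow> inj (\<lambda>x. x + b (v x) * s)"
  shows "strict_mono (\<lambda>x. x + b (v x) * t)"
proof (rule strict_monoI, rule ccontr)
  fix x y :: real
  \<comment> \<open>The distance of two characteristics is affine in time, so reversed order at \<open>t\<close> forces an earlier crossing.\<close>
  assume "x < y" and "\<not> x + b (v x) * t < y + b (v y) * t"
  then have le: "(y - x) \<le> (b (v x) - b (v y)) * t" by (simp add: algebra_simps)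
  then have pos: "0 < b (v x) - b (v y)"
    using \<open>x < y\<close> \<open>0 \<le> t\<close> by (smt (verit) mult_nonneg_nonneg mult_nonpos_nonneg)
  define s where "s = (y - x) / (b (v x) - b (v y))"
  have "0 \<le> s" "s \<le> t" "x + b (v x) * s = y + b (v y) * s"
    using pos le \<open>x < y\<close> by (auto simp: s_def field_simps)
  then show False using inj[of s] \<open>x < y\<close> by (auto dest: injD)
qed

lemma characteristics_surj:
  fixes b v w :: "real \<Rightarrow> real"
  assumes "0 \<le> t" and b: "mono b" "continuous_on UNIV b"
    and v: "continuous_on UNIV v" and w: "continuous_on UNIV w"
    and pos: "\<And>x. 0 < v x"
    and eq: "\<And>x. w (x + b (v x) * t) = v x"
    and mono: "strict_mono (\<lambda>x. x + b (v x) * t)"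
  shows "\<exists>x. x + b (v x) * t = y"
proof -
  define X where "X x = x + b (v x) * t" for x
  have cont: "continuous_on UNIV X"
    unfolding X_def by (intro continuous_intros continuous_on_compose2[OF b(2) v]) auto
  \<comment> \<open>Positivity of \<open>v\<close> and monotonicity of \<open>b\<close> give
    \<open>X x \<ge> x + b 0 * t\<close>. The \<open>max 0\<close> keeps this point to the right of
    the nonpositive one found below, as the intermediate value theorem requires.\<close>
  have up: "y \<le> X (max 0 (y - b 0 * t))"
  proof -
    have "b 0 * t \<le> b (v (max 0 (y - b 0 * t))) * t"
      using b(1) pos \<open>0 \<le> t\<close> by (intro mult_right_mono) (auto intro: monoD less_imp_le)
    then show ?thesis by (simp add: X_def)
  qed
  \<comment> \<open>Were \<open>y\<close> missed from above, \<open>w\<close>, hence \<open>v\<close> on the negative axis, would be bounded on the compact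
    set \<open>{y..X 0}\<close>, and \<open>X x \<le> x + const\<close> would tend to \<open>-\<infinity>\<close>.\<close>
  have "\<exists>x\<le>0. X x \<le> y"
  proof (rule ccontr)
    assume "\<not> (\<exists>x\<le>0. X x \<le> y)"
    then have low: "y < X x" if "x \<le> 0" for x using that by force
    have "compact (w ` {y..X 0})"
      by (intro compact_continuous_image continuous_on_subset[OF w]) auto
    then obtain B where B: "\<And>z. z \<in> {y..X 0} \<Longrightarrow> w z \<le> B"
      using compact_imp_bounded bounded_imp_bdd_above by (metis bdd_above.E image_eqI)
    \<comment> \<open>Far enough left that \<open>x + b B * t \<le> y\<close>; the
      \<open>min 0\<close> keeps \<open>x\<close> where the bound \<open>v x \<le> B\<close> is
      available.\<close>
    define x where "x = min 0 (y - b B * t)"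
    have "x \<le> 0" by (simp add: x_def)
    then have "X x \<in> {y..X 0}"
      using low[of x] strict_mono_less_eq[OF mono, of x 0] by (simp add: X_def)
    then have "v x \<le> B" using B eq by (force simp: X_def)
    then have "X x \<le> x + b B * t"
      using b(1) \<open>0 \<le> t\<close> by (auto simp: X_def intro!: mult_right_mono dest: monoD)
    also have "\<dots> \<le> y" by (simp add: x_def)
    finally show False using low[OF \<open>x \<le> 0\<close>] by simp
  qed
  then obtain x where "x \<le> 0" "X x \<le> y" by blast
  then have "\<exists>z\<ge>x. z \<le> max 0 (y - b 0 * t) \<and> X z = y"
    using up by (intro IVT') (auto intro: continuous_on_subset[OF cont])
  then show ?thesis by (auto simp: X_def)
qed

lemma characteristics_sublevel:
  fixes b v w :: "real \<Rightarrow> real"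
  assumes "0 \<le> t" and b: "mono b"
    and eq: "\<And>x. w (x + b (v x) * t) = v x"
    and mono: "strict_mono (\<lambda>x. x + b (v x) * t)"
    and surj: "\<exists>z. z + b (v z) * t = x"
  shows "w x \<le> U \<longleftrightarrow> v (x - b U * t) \<le> U"
proof -
  obtain x0 where x0: "x = x0 + b (v x0) * t" using surj by blast
  define z where "z = x - b U * t"
  have le: "z' \<le> z'' \<longleftrightarrow> z' + b (v z') * t \<le> z'' + b (v z'') * t" for z' z''
    using strict_mono_less_eq[OF mono, of z' z''] by simp
  have bt: "p \<le> q \<Longrightarrow> b p * t \<le> b q * t" for p q
    using b \<open>0 \<le> t\<close> by (intro mult_right_mono) (auto dest: monoD)
  have wx: "w x = v x0" using eq x0 by simp
  \<comment> \<open>The slope comparison gives \<open>z \<le> x0\<close>, and comparing the images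
    of \<open>z\<close> and \<open>x0\<close> gives \<open>x0 \<le> z\<close>. Equality then
    contradicts the strict separation of \<open>v x0\<close> and \<open>v z\<close> by
    \<open>U\<close>. The second case is the mirror image.\<close>
  have "x0 = z" if "v x0 \<le> U" "U < v z"
    using le[of x0 z] bt[of "v x0" U] bt[of U "v z"] that x0
    by (smt (verit) z_def)
  moreover have "x0 = z" if "U < v x0" "v z \<le> U"
    using le[of z x0] bt[of U "v x0"] bt[of "v z" U] that x0
    by (smt (verit) z_def)
  ultimately show ?thesis unfolding wx z_def[symmetric] by fastforce
qed

lemma strong_solution_imp_continuous_slice:
  assumes "strong_solution a T v u" "t \<in> times_upto T"
  shows "continuous_on UNIV (u t)"
proof -
  have "continuous_on (times_upto T \<times> UNIV) (\<lambda>(t, x). u t x)"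
    using assms by (simp add: strong_solution_def)
  from continuous_on_compose2[OF this continuous_on_Pair[OF continuous_on_const[of UNIV t] continuous_on_id]]
  show ?thesis using assms(2) by auto
qed

text \<open>Continuity of the datum is not assumed: it is read off from the time slice at 0, which
  \<open>0 \<le> T\<close> places in the domain of continuity of \<open>u\<close>.\<close>

lemma strong_solution_imp_continuous_initial:
  assumes "0 \<le> T" "strong_solution a T v u"
  shows "continuous_on UNIV v"
proof -
  have "u 0 = v" using assms(2) by (auto simp: strong_solution_def)
  then show ?thesis
    using strong_solution_imp_continuous_slice[OF assms(2), of 0] \<open>0 \<le> T\<close>
    by (simp add: times_upto_def zero_ereal_def)
qed

lemma no_shock_sublevel:
  assumes conv: "convex_on UNIV a" and diff: "\<And>v. a differentiable (at v)"
    and "0 \<le> T" and t: "t \<in> times_upto T"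
    and pos: "\<And>x. 0 < v x"
    and sol: "strong_solution a T v u" and shock: "no_shock a T v u"
  shows "u t x \<le> U \<longleftrightarrow> v (x - deriv a U * t) \<le> U"
proof -
  have "0 \<le> t" using t by (simp add: times_upto_def)
  have v: "continuous_on UNIV v"
    using \<open>0 \<le> T\<close> sol by (rule strong_solution_imp_continuous_initial)
  have "s \<in> times_upto T" if "0 \<le> s" "s \<le> t" for s
    using that t by (auto simp: times_upto_def intro: order_trans[of _ "ereal t"])
  then have mono: "strict_mono (\<lambda>x. x + deriv a (v x) * t)"
    using shock \<open>0 \<le> t\<close> by (intro non_crossing_imp_strict_mono) (auto simp: no_shock_def)
  have eq: "u t (y + deriv a (v y) * t) = v y" for y
    using shock t by (auto simp: no_shock_def)
  show ?thesis
    using \<open>0 \<le> t\<close> convex_mono_deriv[OF conv diff] eq mono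
      characteristics_surj[OF \<open>0 \<le> t\<close> convex_mono_deriv[OF conv diff]
        convex_continuous_on_deriv[OF conv diff] v strong_solution_imp_continuous_slice[OF sol t] pos eq mono]
    by (rule characteristics_sublevel)
qed

section \<open>Measurability and distribution functions\<close>

text \<open>The weak formulation integrates the initial distribution function over \<open>x\<close>,
  while the data are only known to be measurable in the outcome for each \<open>x\<close>.
  Continuity of the paths links different values of \<open>x\<close>.\<close>

lemma (in prob_space) borel_measurable_cdf_of_continuous_paths:
  fixes X :: "real \<Rightarrow> 'a \<Rightarrow> real"
  assumes X[measurable]: "\<And>x. X x \<in> borel_measurable M"
    and cont: "AE \<omega> in M. continuous_on UNIV (\<lambda>x. X x \<omega>)"
  shows "(\<lambda>x. cdf (distr M borel (X x)) U) \<in> borel_measurable borel"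
proof -
  \<comment> \<open>Continuous approximations of the indicator of \<open>{..U}\<close>: the cdf becomes a limit of continuous functions of \<open>x\<close>.\<close>
  define h where "h k y = max 0 (min 1 (1 - real k * (y - U)))" for k :: nat and y :: real
  have h_cont: "continuous_on UNIV (h k)" for k
    unfolding h_def by (intro continuous_intros)
  have h_meas[measurable]: "h k \<in> borel_measurable borel" for k
    using h_cont by (rule borel_measurable_continuous_onI)
  have h_bound: "norm (h k y) \<le> 1" for k y
    by (auto simp: h_def)
  have h_lim: "(\<lambda>k. h k y) \<longlonglongrightarrow> indicator {..U} y" for y
  proof (cases "y \<le> U")
    case True
    then have "h k y = 1" for k
      by (auto simp: h_def mult_nonneg_nonpos min_def max_def)
    then show ?thesis using True by simp
  next
    case False
    then have "\<forall>\<^sub>F k in sequentially. 1 / (y - U) \<le> real k"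
      using filterlim_real_sequentially by (auto simp: filterlim_at_top)
    then have "\<forall>\<^sub>F k in sequentially. h k y = 0"
    proof eventually_elim
      case (elim k)
      then show ?case using False by (simp add: h_def field_simps)
    qed
    then show ?thesis using False by (simp add: tendsto_eventually)
  qed
  have "(\<lambda>x. \<integral>\<omega>. h k (X x \<omega>) \<partial>M) \<in> borel_measurable borel" for k
  proof (intro borel_measurable_continuous_onI continuous_at_imp_continuous_on ballI)
    fix x :: real
    show "isCont (\<lambda>x. \<integral>\<omega>. h k (X x \<omega>) \<partial>M) x"
      unfolding continuous_at_sequentially comp_def
    proof (intro allI impI)
      fix s assume s: "s \<longlonglongrightarrow> x"
      show "(\<lambda>n. \<integral>\<omega>. h k (X (s n) \<omega>) \<partial>M) \<longlonglongrightarrow> (\<integral>\<omega>. h k (X x \<omega>) \<partial>M)"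
      proof (rule integral_dominated_convergence[where w = "\<lambda>_. 1"])
        show "AE \<omega> in M. (\<lambda>n. h k (X (s n) \<omega>)) \<longlonglongrightarrow> h k (X x \<omega>)"
          using cont
        proof eventually_elim
          case (elim \<omega>)
          then have "continuous_on UNIV (\<lambda>x. h k (X x \<omega>))"
            by (intro continuous_on_compose2[OF h_cont]) auto
          then show ?case
            using s by (auto simp: continuous_on_eq_continuous_at continuous_at_sequentially comp_def)
        qed
      qed (use h_bound in auto)
    qed
  qed
  moreover have "(\<lambda>k. \<integral>\<omega>. h k (X x \<omega>) \<partial>M) \<longlonglongrightarrow> cdf (distr M borel (X x)) U" for x
  proof -
    have "(\<lambda>k. \<integral>\<omega>. h k (X x \<omega>) \<partial>M) \<longlonglongrightarrow> (\<integral>\<omega>. indicator {..U} (X x \<omega>) \<partial>M)"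
      by (rule integral_dominated_convergence[where w = "\<lambda>_. 1"]) (use h_bound h_lim in auto)
    also have "(\<integral>\<omega>. indicator {..U} (X x \<omega>) \<partial>M) = (\<integral>y. (indicator {..U} y :: real) \<partial>distr M borel (X x))"
      using integral_distr[of "X x" M borel "indicator {..U} :: real \<Rightarrow> real"] by simp
    also have "\<dots> = cdf (distr M borel (X x)) U"
      by (simp add: cdf_def)
    finally show ?thesis .
  qed
  ultimately show ?thesis
    by (rule borel_measurable_LIMSEQ_real[rotated])
qed

text \<open>The two events at level \<open>U\<close> differ by a null set, and the completion agrees
  with \<open>M\<close> on sets of \<open>M\<close>. Only one level is compared because in the
  application \<open>X\<close> itself varies with \<open>U\<close>.\<close>

lemma (in prob_space) cdf_pointwise_statistics_eq_of_AE_sublevel: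
  assumes X[measurable]: "X \<in> borel_measurable M"
    and AE: "AE \<omega> in M. f \<omega> \<le> U \<longleftrightarrow> X \<omega> \<le> U"
    and meas: "f \<in> borel_measurable (completion M)"
  shows "cdf (pointwise_statistics M f) U = cdf (distr M borel X) U"
proof -
  interpret C: prob_space "completion M"
    by (rule prob_spaceI) (simp add: emeasure_space_1)
  have "cdf (pointwise_statistics M f) U = measure (completion M) {\<omega> \<in> space M. f \<omega> \<le> U}"
    using meas by (simp add: pointwise_statistics_def cdf_def measure_distr
        vimage_def Int_def conj_commute)
  also have "\<dots> = measure (completion M) {\<omega> \<in> space M. X \<omega> \<le> U}"
  proof (rule C.finite_measure_eq_AE)
    show "AE \<omega> in completion M. (\<omega> \<in> {\<omega> \<in> space M. f \<omega> \<le> U}) = (\<omega> \<in> {\<omega> \<in> space M. X \<omega> \<le> U})"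
      using AE_completion[OF AE] by eventually_elim auto
    show "{\<omega> \<in> space M. f \<omega> \<le> U} \<in> sets (completion M)"
      using meas borel_measurable_iff_le[of "f" "completion M"] by simp
  qed auto
  also have "\<dots> = measure M {\<omega> \<in> space M. X \<omega> \<le> U}"
    by simp
  also have "\<dots> = cdf (distr M borel X) U"
    by (simp add: cdf_def measure_distr vimage_def Int_def conj_commute)
  finally show ?thesis .
qed

text \<open>The comparison variable changes with \<open>U\<close>, so each sublevel set of
  \<open>f\<close> is treated separately: it differs from a measurable set by a null set, which the
  completion makes measurable.\<close>

lemma borel_measurable_completion_of_AE_sublevel:
  fixes f :: "'a \<Rightarrow> real" and X :: "real \<Rightarrow> 'a \<Rightarrow> real"
  assumes X[measurable]: "\<And>U. X U \<in> borel_measurable M"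
    and AE: "\<And>U. AE \<omega> in M. f \<omega> \<le> U \<longleftrightarrow> X U \<omega> \<le> U"
  shows "f \<in> borel_measurable (completion M)"
  unfolding borel_measurable_iff_le
proof (intro allI)
  fix U
  have [measurable]: "X U \<in> borel_measurable (completion M)"
    by (rule measurable_completion) simp
  have [measurable]: "Measurable.pred (completion M) (\<lambda>\<omega>. \<not> (f \<omega> \<le> U \<longleftrightarrow> X U \<omega> \<le> U))"
    using AE by (intro sets_completion_AE) simp
  \<comment> \<open>Exclusive or of the sublevel set of \<open>X U\<close> with the exceptional set;
    it cancels to the sublevel set of \<open>f\<close>.\<close>
  have "{\<omega> \<in> space (completion M). (X U \<omega> \<le> U) \<noteq> (\<not> (f \<omega> \<le> U \<longleftrightarrow> X U \<omega> \<le> U))} \<in> sets (completion M)"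
    by measurable
  also have "{\<omega> \<in> space (completion M). (X U \<omega> \<le> U) \<noteq> (\<not> (f \<omega> \<le> U \<longleftrightarrow> X U \<omega> \<le> U))}
      = {\<omega> \<in> space (completion M). f \<omega> \<le> U}"
    by auto
  finally show "{\<omega> \<in> space (completion M). f \<omega> \<le> U} \<in> sets (completion M)" .
qed

section \<open>Transport equation for travelling profiles\<close>

lemma pointwise_transport_solution_shift:
  assumes "\<And>t x. t \<in> times_upto T \<Longrightarrow> G t x = g (x - c * t)"
  shows "pointwise_transport_solution T c G"
  unfolding pointwise_transport_solution_def
proof (intro ballI allI impI)
  fix t x
  assume t: "t \<in> times_upto T" and "G t differentiable (at x)"
  then obtain D where D: "(G t has_real_derivative D) (at x)"
    by (auto simp: real_differentiable_def)
  have "G t = (\<lambda>y. g (y - c * t))" using assms t by auto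
  have "((\<lambda>y. g ((y + c * t) - c * t)) has_real_derivative D) (at (x - c * t))"
    using D unfolding \<open>G t = _\<close> by (subst DERIV_shift[symmetric]) simp
  then have g: "(g has_real_derivative D) (at (x - c * t))" by simp
  have "((\<lambda>s. g (x - c * s)) has_real_derivative D * (- c)) (at t)"
    by (rule DERIV_chain2[of g _ "\<lambda>s. x - c * s", OF g])
      (rule derivative_eq_intros refl | simp)+
  \<comment> \<open>Restricted before replacing the profile by \<open>G\<close>, since the two are
    known to agree only on \<open>times_upto T\<close>.\<close>
  then have "((\<lambda>s. g (x - c * s)) has_real_derivative D * (- c)) (at t within times_upto T)"
    by (rule DERIV_subset) simp
  then have "((\<lambda>s. G s x) has_real_derivative D * (- c)) (at t within times_upto T)"
    by (rule has_field_derivative_transform_within[of _ _ _ _ 1]) (use assms t in auto)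
  then show "\<exists>Gt Gx. ((\<lambda>s. G s x) has_real_derivative Gt) (at t within times_upto T) \<and>
      (G t has_real_derivative Gx) (at x) \<and> Gt + c * Gx = 0"
    using D by (intro exI[of _ "D * (- c)"] exI[of _ D]) auto
qed

text \<open>\<open>\<psi>\<close> vanishes on the open complement of its support, so uniqueness of
  the derivative forces both partial derivatives to vanish there too.\<close>

lemma test_function_outside_support:
  assumes "test_function T \<psi> \<psi>t \<psi>x" and p: "p \<notin> closure {p. \<psi> p \<noteq> 0}"
  shows "\<psi> p = 0" "\<psi>t p = 0" "\<psi>x p = 0"
proof -
  define S where "S = closure {p. \<psi> p \<noteq> 0}"
  have D: "(\<psi> has_derivative (\<lambda>h. \<psi>t p * fst h + \<psi>x p * snd h)) (at p)"
    using assms unfolding test_function_def by blast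
  have van: "\<psi> q = 0" if "q \<in> - S" for q
    using that closure_subset[of "{p. \<psi> p \<noteq> 0}"] by (auto simp: S_def)
  show "\<psi> p = 0" using p by (intro van) (simp add: S_def)
  have "(\<psi> has_derivative (\<lambda>h. 0)) (at p)"
  proof (rule has_derivative_transform_within_open)
    show "((\<lambda>_. 0) has_derivative (\<lambda>h. 0)) (at p)" by simp
    show "open (- S)" "p \<in> - S" using p by (auto simp: S_def)
  qed (use van in auto)
  then have eq: "(\<lambda>h. \<psi>t p * fst h + \<psi>x p * snd h) = (\<lambda>h. 0)"
    by (rule has_derivative_unique[OF D])
  show "\<psi>t p = 0" "\<psi>x p = 0"
    using fun_cong[OF eq, of "(1, 0)"] fun_cong[OF eq, of "(0, 1)"] by auto
qed

text \<open>All derivatives fall on the test function, so \<open>g\<close> may be merely bounded and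
  measurable: after the shear it is constant in time and leaves the inner integral.\<close>

lemma weak_transport_solution_shift:
  fixes g :: "real \<Rightarrow> real"
  assumes G: "\<And>t x. t \<in> times_upto T \<Longrightarrow> G t x = g (x - c * t)"
    and g[measurable]: "g \<in> borel_measurable borel"
    and bound: "\<And>x. \<bar>g x\<bar> \<le> B"
    and "0 \<le> T"
  shows "weak_transport_solution T c G g"
  unfolding weak_transport_solution_def
proof (intro allI impI)
  fix \<psi> \<psi>t \<psi>x
  assume test: "test_function T \<psi> \<psi>t \<psi>x"
  define S where "S = closure {p. \<psi> p \<noteq> 0}"
  have S: "compact S" "\<And>p. p \<in> S \<Longrightarrow> ereal (fst p) < T"
    using test by (auto simp: test_function_def S_def)
  have van: "\<psi> p = 0" "\<psi>t p = 0" "\<psi>x p = 0" if "p \<notin> S" for p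
    using that unfolding S_def by (fact test_function_outside_support[OF test])+
  have cont_t: "continuous_on UNIV \<psi>t" and cont_x: "continuous_on UNIV \<psi>x"
    using test by (auto simp: test_function_def)
  have D: "(\<psi> has_derivative (\<lambda>h. \<psi>t p * fst h + \<psi>x p * snd h)) (at p)" for p
    using test unfolding test_function_def by blast
  obtain R where R: "\<And>p. p \<in> S \<Longrightarrow> norm p \<le> R"
    using compact_imp_bounded[OF S(1)] by (auto simp: bounded_iff)
  have S_box: "\<bar>t\<bar> \<le> R \<and> \<bar>x\<bar> \<le> R" if "(t, x) \<in> S" for t x
    using R[OF that] norm_fst_le[of t x] norm_snd_le[of x t] by auto
  \<comment> \<open>A finite time horizon: \<open>T\<close> itself if finite, otherwise a time
    beyond the support. In both cases \<open>\<psi>\<close> vanishes at time \<open>M\<close>. The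
    \<open>max 0\<close> covers an empty support, for which \<open>R\<close> may be
    negative.\<close>
  obtain M where M: "0 \<le> M" "\<And>t x. (t, x) \<in> S \<Longrightarrow> t < M"
      "\<And>t x. (t, x) \<in> S \<Longrightarrow> t \<in> times_upto T \<longleftrightarrow> t \<in> {0..M}"
  proof (cases T)
    case (real r)
    then show ?thesis
      using that[of r] \<open>0 \<le> T\<close> S(2) by (force simp: times_upto_def)
  next
    case PInf
    then show ?thesis
      using that[of "max 0 R + 1"] S_box by (force simp: times_upto_def)
  qed (use \<open>0 \<le> T\<close> in auto)
  define q where "q p = \<psi>t p + c * \<psi>x p" for p
  have cont_q: "continuous_on UNIV q"
    unfolding q_def by (intro continuous_intros cont_t cont_x)
  have q_meas[measurable]: "q \<in> borel_measurable (borel \<Otimes>\<^sub>M borel)"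
    using borel_measurable_continuous_onI[OF cont_q] by (simp add: borel_prod)
  have q_van: "q p = 0" if "p \<notin> S" for p using van that by (simp add: q_def)
  have "compact (q ` S)"
    by (intro compact_continuous_image continuous_on_subset[OF cont_q] S) auto
  then obtain Q where Q: "\<And>p. p \<in> S \<Longrightarrow> \<bar>q p\<bar> \<le> Q"
    using compact_imp_bounded by (force simp: bounded_iff)
  have q_bound: "\<bar>q p\<bar> \<le> max 0 Q" for p
    using Q[of p] q_van[of p] by (cases "p \<in> S") auto
  have "0 \<le> B" using bound[of 0] by simp
  have bound_gq: "norm (indicator {0..M} t * g y * q p) \<le> B * max 0 Q" for t y p
    using mult_mono[OF bound[of y] q_bound[of p]] \<open>0 \<le> B\<close>
    by (auto simp: abs_mult indicator_def)
  \<comment> \<open>\<open>f\<close> is the integrand with the time interval cut to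
    \<open>{0..M}\<close>; \<open>k\<close> is \<open>f\<close> in the coordinate
    \<open>y = x - c * t\<close>.\<close>
  define f where "f = (\<lambda>(t, x). indicator {0..M} t * g (x - c * t) * q (t, x))"
  define k where "k = (\<lambda>(t, y). indicator {0..M} t * g y * q (t, y + c * t))"
  have int_f: "integrable (lborel \<Otimes>\<^sub>M lborel) f"
    unfolding lborel_prod
  proof (rule integrableI_bounded_set[where A = "cbox (0, - R) (M, R)" and B = "B * max 0 Q"])
    show "f \<in> borel_measurable lborel"
      unfolding f_def lborel_prod[symmetric] by measurable
    have "f (t, x) = 0" if "(t, x) \<notin> cbox (0, - R) (M, R)" for t x
    proof (cases "t \<in> {0..M} \<and> (t, x) \<in> S")
      case True
      then show ?thesis using that S_box[of t x] by (auto simp: cbox_Pair_eq abs_le_iff)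
    qed (auto simp: f_def q_van)
    then show "AE p in lborel. p \<notin> cbox (0, - R) (M, R) \<longrightarrow> f p = 0"
      by (intro AE_I2) (metis prod.exhaust)
    show "AE p in lborel. p \<in> cbox (0, - R) (M, R) \<longrightarrow> norm (f p) \<le> B * max 0 Q"
      by (simp add: f_def case_prod_beta bound_gq del: real_norm_def)
  qed (simp_all only: emeasure_lborel_cbox_finite  sets_lborel borel_closed closed_cbox )
  \<comment> \<open>The shear moves points by at most \<open>\<bar>c\<bar> * M\<close> up to time
    \<open>M\<close>, so the box is widened by that amount.\<close>
  define R' where "R' = R + \<bar>c\<bar> * M"
  have int_k: "integrable (lborel \<Otimes>\<^sub>M lborel) k"
    unfolding lborel_prod
  proof (rule integrableI_bounded_set[where A = "cbox (0, - R') (M, R')" and B = "B * max 0 Q"])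
    show "k \<in> borel_measurable lborel"
      unfolding k_def lborel_prod[symmetric] by measurable
    have "k (t, y) = 0" if "(t, y) \<notin> cbox (0, - R') (M, R')" for t y
    proof (cases "t \<in> {0..M} \<and> (t, y + c * t) \<in> S")
      case True
      then have "\<bar>y + c * t\<bar> \<le> R" and "\<bar>c * t\<bar> \<le> \<bar>c\<bar> * M"
        using S_box by (auto simp: abs_mult intro: mult_left_mono)
      then have "\<bar>y\<bar> \<le> R'" unfolding R'_def by linarith
      then show ?thesis using that True by (auto simp: cbox_Pair_eq abs_le_iff)
    qed (auto simp: k_def q_van)
    then show "AE p in lborel. p \<notin> cbox (0, - R') (M, R') \<longrightarrow> k p = 0"
      by (intro AE_I2) (metis prod.exhaust)
    show "AE p in lborel. p \<in> cbox (0, - R') (M, R') \<longrightarrow> norm (k p) \<le> B * max 0 Q"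
      by (simp add: k_def case_prod_beta bound_gq del: real_norm_def)
  qed (simp_all only: emeasure_lborel_cbox_finite  sets_lborel borel_closed closed_cbox )
  have f_eq: "indicator (times_upto T \<times> UNIV) p *\<^sub>R (G (fst p) (snd p) * (\<psi>t p + c * \<psi>x p)) = f p" for p
  proof (cases "p \<in> S")
    case True
    then show ?thesis
      using M(3)[of "fst p" "snd p"] G
      by (cases p) (auto simp: f_def q_def indicator_def)
  next
    case False
    then show ?thesis by (simp add: f_def q_def van case_prod_beta)
  qed
  \<comment> \<open>At fixed \<open>t\<close> the shear is a translation, so translation invariance
    on the line replaces a planar change of variables.\<close>
  have slice: "(\<integral>x. f (t, x) \<partial>lborel) = (\<integral>y. k (t, y) \<partial>lborel)" for t
    by (subst lborel_integral_real_affine[where c = 1 and t = "c * t"]) (simp_all add: f_def k_def add.commute)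
  have path: "((\<lambda>t. \<psi> (t, y + c * t)) has_real_derivative q (t, y + c * t)) (at t)" for t y
  proof -
    have "((\<lambda>t. (t, y + c * t)) has_derivative (\<lambda>h. (h, c * h))) (at t)"
      by (auto intro!: derivative_eq_intros)
    then have "((\<lambda>t. \<psi> (t, y + c * t)) has_derivative
        (\<lambda>h. \<psi>t (t, y + c * t) * h + \<psi>x (t, y + c * t) * (c * h))) (at t)"
      using has_derivative_compose[OF _ D] by fastforce
    then show ?thesis
      unfolding has_field_derivative_def
      by (rule has_derivative_eq_rhs) (auto simp: q_def fun_eq_iff algebra_simps)
  qed
  \<comment> \<open>\<open>q\<close> is the derivative of \<open>\<psi>\<close> along the line
    through \<open>y\<close> of slope \<open>c\<close>. The end value at \<open>M\<close> vanishes
    and the one at 0 yields the initial term.\<close>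
  have time: "(\<integral>t. k (t, y) \<partial>lborel) = - (g y * \<psi> (0, y))" for y
  proof -
    have "continuous_on UNIV (\<lambda>t. q (t, y + c * t))"
      by (intro continuous_on_compose2[OF cont_q] continuous_on_Pair continuous_on_add
          continuous_on_mult continuous_on_const continuous_on_id) simp
    then have "isCont (\<lambda>t. q (t, y + c * t)) t" for t
      by (simp add: continuous_on_eq_continuous_at)
    then have "(\<integral>t. q (t, y + c * t) * indicator {0..M} t \<partial>lborel) = \<psi> (M, y + c * M) - \<psi> (0, y + c * 0)"
      by (rule integral_FTC_Icc_real[where f = "\<lambda>t. q (t, y + c * t)" and F = "\<lambda>t. \<psi> (t, y + c * t)", OF M(1) path])
    moreover have "\<psi> (M, y + c * M) = 0" using M(2) van by blast
    moreover have "(\<integral>t. k (t, y) \<partial>lborel) = (\<integral>t. g y * (q (t, y + c * t) * indicator {0..M} t) \<partial>lborel)"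
      by (simp add: k_def mult_ac)
    ultimately show ?thesis by simp
  qed
  have "(LINT p:times_upto T \<times> UNIV|lborel. G (fst p) (snd p) * (\<psi>t p + c * \<psi>x p))
      = integral\<^sup>L (lborel \<Otimes>\<^sub>M lborel) f"
    by (simp only: set_lebesgue_integral_def f_eq lborel_prod)
  also have "\<dots> = (\<integral>t. (\<integral>x. f (t, x) \<partial>lborel) \<partial>lborel)"
    by (rule lborel_pair.integral_fst'[OF int_f, symmetric])
  also have "\<dots> = (\<integral>t. (\<integral>y. k (t, y) \<partial>lborel) \<partial>lborel)"
    by (simp only: slice)
  also have "\<dots> = (\<integral>y. (\<integral>t. k (t, y) \<partial>lborel) \<partial>lborel)"
    by (rule lborel_pair.Fubini_integral[symmetric]) (simp only: case_prod_eta int_k)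
  also have "\<dots> = - (\<integral>y. g y * \<psi> (0, y) \<partial>lborel)"
    by (simp only: time integral_minus)
  finally have eq: "(LINT p:times_upto T \<times> UNIV|lborel. G (fst p) (snd p) * (\<psi>t p + c * \<psi>x p))
      = - (\<integral>y. g y * \<psi> (0, y) \<partial>lborel)" .
  \<comment> \<open>Integrability of the initial term comes from Fubini: up to sign it is the time
    integral of \<open>k\<close>.\<close>
  have "integrable lborel (\<lambda>y. \<integral>t. k (t, y) \<partial>lborel)"
    by (rule lborel_pair.integrable_snd) (simp only: case_prod_eta int_k)
  then have "integrable lborel (\<lambda>y. g y * \<psi> (0, y))"
    by (simp add: time)
  moreover have "set_integrable lborel (times_upto T \<times> UNIV)
      (\<lambda>(t, x). G t x * (\<psi>t (t, x) + c * \<psi>x (t, x)))"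
    using int_f by (simp only: set_integrable_def lborel_prod case_prod_beta prod.collapse f_eq)
  ultimately show "set_integrable lborel (times_upto T \<times> UNIV)
      (\<lambda>(t, x). G t x * (\<psi>t (t, x) + c * \<psi>x (t, x))) \<and>
      integrable lborel (\<lambda>x. g x * \<psi> (0, x)) \<and>
      (LINT p:times_upto T \<times> UNIV|lborel. G (fst p) (snd p) * (\<psi>t p + c * \<psi>x p))
        + (LINT x|lborel. g x * \<psi> (0, x)) = 0"
    using eq by simp
qed

theorem theorem3p1:
  fixes a :: "real \<Rightarrow> real"
    and \<Omega> :: "(real ^ 'd) set"
    and \<mu> :: "(real ^ 'd) measure"
    and u0 :: "real \<Rightarrow> real ^ 'd \<Rightarrow> real"
    and u :: "real \<Rightarrow> real \<Rightarrow> real ^ 'd \<Rightarrow> real"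
    and T :: ereal
  assumes "prob_space \<mu>" and "sets \<mu> = sets (restrict_space borel \<Omega>)"
    and "\<And>v. 0 \<le> a v" and "\<And>v. a differentiable (at v)" and "strictly_convex a"
    and "\<And>x. u0 x \<in> borel_measurable \<mu>"
    and "0 \<le> T"
    and "AE \<omega> in \<mu>. (\<forall>x. 0 < u0 x \<omega>) \<and>
           unique_strong_solution a T (\<lambda>x. u0 x \<omega>) (\<lambda>t x. u t x \<omega>) \<and>
           no_shock a T (\<lambda>x. u0 x \<omega>) (\<lambda>t x. u t x \<omega>)"
  shows "(\<forall>t\<in>times_upto T. \<forall>x. u t x \<in> borel_measurable (completion \<mu>)) \<and>
    (\<forall>U. weak_transport_solution T (deriv a U)
            (\<lambda>t x. statistics_cdf \<mu> u t x U)
            (\<lambda>x. cdf (distr \<mu> borel (u0 x)) U) \<and>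
         pointwise_transport_solution T (deriv a U) (\<lambda>t x. statistics_cdf \<mu> u t x U) \<and>
         (\<forall>x. statistics_cdf \<mu> u 0 x U = cdf (distr \<mu> borel (u0 x)) U) \<and>
         (\<forall>t\<in>times_upto T. \<forall>x.
            statistics_cdf \<mu> u t x U = statistics_cdf \<mu> u 0 (x - deriv a U * t) U))"
proof -
  interpret prob_space \<mu> by fact
  define g where "g U x = cdf (distr \<mu> borel (u0 x)) U" for U x
  have u0_meas[measurable]: "u0 x \<in> borel_measurable \<mu>" for x by fact
  have conv: "convex_on UNIV a"
    using assms(5) by (rule strictly_convex_imp_convex_on)
  have zero: "0 \<in> times_upto T"
    using \<open>0 \<le> T\<close> by (simp add: times_upto_def zero_ereal_def)
  have sublevel: "AE \<omega> in \<mu>. u t x \<omega> \<le> U \<longleftrightarrow> u0 (x - deriv a U * t) \<omega> \<le> U"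
    if "t \<in> times_upto T" for t x U
    using assms(8)
  proof eventually_elim
    case (elim \<omega>)
    then show ?case
      using no_shock_sublevel[OF conv assms(4) \<open>0 \<le> T\<close> that, of "\<lambda>x. u0 x \<omega>" "\<lambda>t x. u t x \<omega>" x U]
      by (simp add: unique_strong_solution_def)
  qed
  \<comment> \<open>Measurability of \<open>u t x\<close> is a conclusion: the equivalence with a
    measurable event at every level \<open>U\<close> supplies it.\<close>
  have meas: "u t x \<in> borel_measurable (completion \<mu>)" if "t \<in> times_upto T" for t x
    by (rule borel_measurable_completion_of_AE_sublevel[OF u0_meas sublevel[OF that]])
  have F: "statistics_cdf \<mu> u t x U = g U (x - deriv a U * t)" if "t \<in> times_upto T" for t x U
    unfolding g_def statistics_cdf_def
    by (rule cdf_pointwise_statistics_eq_of_AE_sublevel[OF u0_meas sublevel meas]) (fact that)+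
  have paths: "AE \<omega> in \<mu>. continuous_on UNIV (\<lambda>x. u0 x \<omega>)"
    using assms(8)
  proof eventually_elim
    case (elim \<omega>)
    then show ?case
      using strong_solution_imp_continuous_initial[OF \<open>0 \<le> T\<close>] by (auto simp: unique_strong_solution_def)
  qed
  have g_meas: "g U \<in> borel_measurable borel" for U
    unfolding g_def by (rule borel_measurable_cdf_of_continuous_paths[OF u0_meas paths])
  have g_bound: "\<bar>g U x\<bar> \<le> 1" for U x
  proof -
    interpret D: prob_space "distr \<mu> borel (u0 x)" by (rule prob_space_distr) simp
    show ?thesis by (simp add: g_def cdf_def)
  qed
  have "weak_transport_solution T (deriv a U) (\<lambda>t x. statistics_cdf \<mu> u t x U) (g U)" for U
    by (rule weak_transport_solution_shift[OF _ g_meas g_bound \<open>0 \<le> T\<close>]) (rule F)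
  moreover have "pointwise_transport_solution T (deriv a U) (\<lambda>t x. statistics_cdf \<mu> u t x U)" for U
    by (rule pointwise_transport_solution_shift[where g = "g U"]) (rule F)
  ultimately show ?thesis
    using meas zero F unfolding g_def by simp
qed

end
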